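(* Let $X$ be a finite metric space whose similarity matrix $Z_X$ is invertible. Then the space of lines to $X$, $\mathcal{L}(X)$, contains a dense open subset each of whose elements $(Y_{f,t})_{0<t\le1}$ satisfies $\lim_{t\to0}|Y_{f,t}|=|X|$.
   Context: For a finite metric space $(X,d)$, the similarity matrix $Z_X$ has entries $Z_X(x,y)=e^{-d(x,y)}$. A weighting is $\mathbf{w}\in\mathbb{R}^X$ with $Z_X\mathbf{w}=(1,\dots,1)^\top$; if one exists, the magnitude $|X|$ is the sum of its entries (independent of choice). For finite metric spaces $(X,d_X)$, $(Y,d_Y)$ and a surjection $f\colon Y\to X$, the line from $Y$ to $X$ along $f$ is the family $(Y_{f,t})_{0<t\le1}$, $Y_{f,t}=(Y,d_{f,t})$ with $d_{f,t}(y,y')=t\,d_Y(y,y')+(1-t)\,d_X(f(y),f(y'))$. The set $\mathcal{L}(X)$ of lines to $X$ consists of all such lines modulo: $(Y_{f,t})\sim(Y_{g,t})$ if there are isometries $h\colon Y\to Y$, $k\colon X\to X$ with $k\circ f=g\circ h$. Topology: label $X=\{x_1,\dots,x_m\}$. Let $\mathrm{Met}_n\subset\mathbb{R}^{n\times n}$ be the set of distance matrices of ordered $n$-point metric spaces, with the Euclidean topology. A line along $f\colon Y\to X$, $\#Y=n$, with $r_i=\#f^{-1}(x_i)$ and $f^{-1}(x_i)=\{y_i^1,\dots,y_i^{r_i}\}$, is represented by the distance matrix of $Y$ in the ordering $(y_1^1,\dots,y_1^{r_1},\dots,y_m^1,\dots,y_m^{r_m})$, in the component indexed by $(r_1,\dots,r_m)$.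 This induces a bijection of $\mathcal{L}(X)$ with $\big(\bigsqcup_{(r_1,\dots,r_m),\,r_i\ge1,\,n=\sum r_i}\mathrm{Met}_n/(\mathfrak{S}_{r_1}\times\cdots\times\mathfrak{S}_{r_m})\big)/\mathrm{Iso}(X)$, where $\mathfrak{S}_{r_i}$ permutes rows and columns simultaneously within the $i$-th block and $\mathrm{Iso}(X)\subseteq\mathfrak{S}_m$ permutes the blocks. $\mathcal{L}(X)$ is given the topology transported via this bijection from the quotient topology (Euclidean topology on each $\mathrm{Met}_n$, then quotient by the finite groups, then quotient by $\mathrm{Iso}(X)$). *)

theory Defs
  imports Complex_Main
begin

text \<open>Finite metric spaces are represented by distance matrices on the index
set {0..<n}: a function D :: nat => nat => real, of which only the entries
D i j with i, j < n matter.\<close>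

definition is_metric :: "nat \<Rightarrow> (nat \<Rightarrow> nat \<Rightarrow> real) \<Rightarrow> bool" where
  "is_metric n D \<longleftrightarrow>
     (\<forall>i<n. \<forall>j<n. 0 \<le> D i j \<and> (D i j = 0 \<longleftrightarrow> i = j) \<and> D i j = D j i) \<and>
     (\<forall>i<n. \<forall>j<n. \<forall>k<n. D i k \<le> D i j + D j k)"

definition sim :: "(nat \<Rightarrow> nat \<Rightarrow> real) \<Rightarrow> nat \<Rightarrow> nat \<Rightarrow> real" where
  "sim D i j = exp (- D i j)"

definition sim_invertible :: "nat \<Rightarrow> (nat \<Rightarrow> nat \<Rightarrow> real) \<Rightarrow> bool" where
  "sim_invertible n D \<longleftrightarrow> (\<exists>W :: nat \<Rightarrow> nat \<Rightarrow> real.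
     (\<forall>i<n. \<forall>j<n. (\<Sum>k<n. sim D i k * W k j) = (if i = j then 1 else 0)) \<and>
     (\<forall>i<n. \<forall>j<n. (\<Sum>k<n. W i k * sim D k j) = (if i = j then 1 else 0)))"

definition is_weighting :: "nat \<Rightarrow> (nat \<Rightarrow> nat \<Rightarrow> real) \<Rightarrow> (nat \<Rightarrow> real) \<Rightarrow> bool" where
  "is_weighting n D w \<longleftrightarrow> (\<forall>i<n. (\<Sum>j<n. sim D i j * w j) = 1)"

definition has_magnitude :: "nat \<Rightarrow> (nat \<Rightarrow> nat \<Rightarrow> real) \<Rightarrow> bool" where
  "has_magnitude n D \<longleftrightarrow> (\<exists>w. is_weighting n D w)"

definition magnitude :: "nat \<Rightarrow> (nat \<Rightarrow> nat \<Rightarrow> real) \<Rightarrow> real" where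
  "magnitude n D = (SOME s. \<exists>w. is_weighting n D w \<and> s = (\<Sum>i<n. w i))"

text \<open>A line to X = {x_0,...,x_(m-1)} is represented by a block-size list rs
(rs ! i = #f^{-1}(x_i) >= 1) and the distance matrix D of Y on
{0..<sum_list rs}, with points ordered blockwise. The block index of a point
is its image under f. Entries outside the index range are normalised to 0.\<close>

definition blk :: "nat list \<Rightarrow> nat \<Rightarrow> nat" where
  "blk rs a = (LEAST i. a < sum_list (take (Suc i) rs))"

definition line_reps :: "nat \<Rightarrow> (nat list \<times> (nat \<Rightarrow> nat \<Rightarrow> real)) set" where
  "line_reps m = {(rs, D). length rs = m \<and> (\<forall>r\<in>set rs. 1 \<le> r) \<and>
      is_metric (sum_list rs) D \<and>
      (\<forall>i j. (sum_list rs \<le> i \<or> sum_list rs \<le> j) \<longrightarrow> D i j = 0)}"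

definition is_isometry :: "nat \<Rightarrow> (nat \<Rightarrow> nat \<Rightarrow> real) \<Rightarrow> (nat \<Rightarrow> nat) \<Rightarrow> bool" where
  "is_isometry m dX k \<longleftrightarrow> bij_betw k {0..<m} {0..<m} \<and>
      (\<forall>i<m. \<forall>j<m. dX (k i) (k j) = dX i j)"

definition line_equiv :: "nat \<Rightarrow> (nat \<Rightarrow> nat \<Rightarrow> real) \<Rightarrow>
    ((nat list \<times> (nat \<Rightarrow> nat \<Rightarrow> real)) \<times> (nat list \<times> (nat \<Rightarrow> nat \<Rightarrow> real))) set" where
  "line_equiv m dX = {((rs, D), (rs', D')).
      (rs, D) \<in> line_reps m \<and> (rs', D') \<in> line_reps m \<and>
      (\<exists>h k. is_isometry m dX k \<and>
         bij_betw h {0..<sum_list rs} {0..<sum_list rs'} \<and>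
         (\<forall>a<sum_list rs. \<forall>b<sum_list rs. D' (h a) (h b) = D a b) \<and>
         (\<forall>a<sum_list rs. k (blk rs a) = blk rs' (h a)))}"

definition lines :: "nat \<Rightarrow> (nat \<Rightarrow> nat \<Rightarrow> real) \<Rightarrow>
    (nat list \<times> (nat \<Rightarrow> nat \<Rightarrow> real)) set set" where
  "lines m dX = line_reps m // line_equiv m dX"

text \<open>Open sets of the disjoint union of the Met_n (Euclidean topology on each
component, components indexed by rs).\<close>
definition reps_open :: "nat \<Rightarrow> (nat list \<times> (nat \<Rightarrow> nat \<Rightarrow> real)) set \<Rightarrow> bool" where
  "reps_open m U \<longleftrightarrow> U \<subseteq> line_reps m \<and>
     (\<forall>(rs, D)\<in>U. \<exists>e>0. \<forall>D'. (rs, D') \<in> line_reps m \<and>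
        (\<forall>i<sum_list rs. \<forall>j<sum_list rs. \<bar>D' i j - D i j\<bar> < e) \<longrightarrow> (rs, D') \<in> U)"

definition lines_open :: "nat \<Rightarrow> (nat \<Rightarrow> nat \<Rightarrow> real) \<Rightarrow>
    (nat list \<times> (nat \<Rightarrow> nat \<Rightarrow> real)) set set \<Rightarrow> bool" where
  "lines_open m dX V \<longleftrightarrow> V \<subseteq> lines m dX \<and> reps_open m (\<Union>V)"

definition lines_dense :: "nat \<Rightarrow> (nat \<Rightarrow> nat \<Rightarrow> real) \<Rightarrow>
    (nat list \<times> (nat \<Rightarrow> nat \<Rightarrow> real)) set set \<Rightarrow> bool" where
  "lines_dense m dX V \<longleftrightarrow> V \<subseteq> lines m dX \<and>
     (\<forall>W. lines_open m dX W \<and> W \<noteq> {} \<longrightarrow> W \<inter> V \<noteq> {})"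

definition line_dist :: "(nat \<Rightarrow> nat \<Rightarrow> real) \<Rightarrow> nat list \<Rightarrow> (nat \<Rightarrow> nat \<Rightarrow> real) \<Rightarrow>
    real \<Rightarrow> nat \<Rightarrow> nat \<Rightarrow> real" where
  "line_dist dX rs D t a b = t * D a b + (1 - t) * dX (blk rs a) (blk rs b)"

end

theory Submission
  imports Defs "Jordan_Normal_Form.Char_Poly"
begin

text \<open>
Write f for the map Y to X and N(a,b) = Z(f a, f b) D(a,b). At t = 0 the similarity matrix of the
line is the pullback of Z along f, which is degenerate: its kernel K consists of the vectors whose
sums over all fibres of f vanish. Replacing, for every a outside a chosen section p of f, row a by
(row a - row p(f a)) / t preserves the weightings and makes the matrix converge. The limit is
invertible exactly when N is nondegenerate as a bilinear form on K. In that case the weightings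
converge by Cramer's rule, and the fibre sums of the limit form a weighting of X.

Nondegeneracy is an open condition. It is dense because adding s times the discrete metric to D
changes N by -s times the identity on K, so that only finitely many s, eigenvalues of a fixed
matrix, are bad.
\<close>

section \<open>Determinants, Cramer's rule and limits of linear systems\<close>

definition mat_injective :: "nat \<Rightarrow> (nat \<Rightarrow> nat \<Rightarrow> real) \<Rightarrow> bool" where
  "mat_injective n A \<longleftrightarrow>
     (\<forall>u. (\<forall>i<n. (\<Sum>j<n. A i j * u j) = 0) \<longrightarrow> (\<forall>j<n. u j = 0))"

lemma mat_injective_iff_det:
  "mat_injective n A \<longleftrightarrow> det (mat n n (\<lambda>(i, j). A i j)) \<noteq> 0"
proof -
  let ?M = "mat n n (\<lambda>(i, j). A i j)"
  have mult: "?M *\<^sub>v v = 0\<^sub>v n \<longleftrightarrow> (\<forall>i<n. (\<Sum>j<n. A i j * v $ j) = 0)"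
    if "v \<in> carrier_vec n" for v
    using that by (auto simp: vec_eq_iff scalar_prod_def lessThan_atLeast0)
  have "det ?M = 0 \<longleftrightarrow> (\<exists>v. v \<in> carrier_vec n \<and> v \<noteq> 0\<^sub>v n \<and> ?M *\<^sub>v v = 0\<^sub>v n)"
    by (rule det_0_iff_vec_prod_zero) simp
  also have "\<dots> \<longleftrightarrow> \<not> mat_injective n A"
  proof
    assume "\<exists>v. v \<in> carrier_vec n \<and> v \<noteq> 0\<^sub>v n \<and> ?M *\<^sub>v v = 0\<^sub>v n"
    then obtain v where v: "v \<in> carrier_vec n" "v \<noteq> 0\<^sub>v n" "?M *\<^sub>v v = 0\<^sub>v n"
      by blast
    then have "\<forall>i<n. (\<Sum>j<n. A i j * v $ j) = 0"
      using mult by blast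
    moreover have "\<exists>j<n. v $ j \<noteq> 0"
      using v by (auto simp: vec_eq_iff)
    ultimately show "\<not> mat_injective n A"
      unfolding mat_injective_def by blast
  next
    assume "\<not> mat_injective n A"
    then obtain u j where u: "\<forall>i<n. (\<Sum>j<n. A i j * u j) = 0" "j < n" "u j \<noteq> 0"
      unfolding mat_injective_def by blast
    have "vec n u \<noteq> 0\<^sub>v n"
      using u(2,3) by (auto simp: vec_eq_iff)
    moreover have "?M *\<^sub>v vec n u = 0\<^sub>v n"
      using u(1) by (subst mult) auto
    ultimately show "\<exists>v. v \<in> carrier_vec n \<and> v \<noteq> 0\<^sub>v n \<and> ?M *\<^sub>v v = 0\<^sub>v n"
      by (intro exI[of _ "vec n u"]) simp
  qed
  finally show ?thesis by blast
qed

text \<open>The Leibniz formula writes the determinant as a polynomial in the entries. The filter is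
  arbitrary because limits occur both along sequences and as t tends to 0 from the right.\<close>

lemma tendsto_det:
  fixes M :: "'b \<Rightarrow> real mat"
  assumes "\<And>t. M t \<in> carrier_mat n n" "L \<in> carrier_mat n n"
    and "\<And>i j. i < n \<Longrightarrow> j < n \<Longrightarrow> ((\<lambda>t. M t $$ (i, j)) \<longlongrightarrow> L $$ (i, j)) F"
  shows "((\<lambda>t. det (M t)) \<longlongrightarrow> det L) F"
proof -
  have "((\<lambda>t. \<Sum>p | p permutes {0..<n}. signof p * (\<Prod>i = 0..<n. M t $$ (i, p i)))
      \<longlongrightarrow> (\<Sum>p | p permutes {0..<n}. signof p * (\<Prod>i = 0..<n. L $$ (i, p i)))) F"
    by (intro tendsto_sum tendsto_mult tendsto_const tendsto_prod assms(3))
      (auto simp: permutes_in_image[where S = "{0..<n}", simplified])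
  then show ?thesis
    by (simp add: det_def'[OF assms(1)] det_def'[OF assms(2)])
qed

lemma tendsto_cofactor:
  fixes M :: "'b \<Rightarrow> real mat"
  assumes "\<And>t. M t \<in> carrier_mat n n" "L \<in> carrier_mat n n"
    and "\<And>i j. i < n \<Longrightarrow> j < n \<Longrightarrow> ((\<lambda>t. M t $$ (i, j)) \<longlongrightarrow> L $$ (i, j)) F"
  shows "((\<lambda>t. cofactor (M t) i j) \<longlongrightarrow> cofactor L i j) F"
  unfolding cofactor_def
proof (intro tendsto_mult tendsto_const tendsto_det)
  show "mat_delete (M t) i j \<in> carrier_mat (n - 1) (n - 1)" for t
    using assms(1) by (rule mat_delete_carrier)
  show "mat_delete L i j \<in> carrier_mat (n - 1) (n - 1)"
    using assms(2) by (rule mat_delete_carrier)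
  have [simp]: "dim_row (M t) = n" "dim_col (M t) = n" "dim_row L = n" "dim_col L = n" for t
    using assms(1)[of t] assms(2) by auto
  show "((\<lambda>t. mat_delete (M t) i j $$ (k, l)) \<longlongrightarrow> mat_delete L i j $$ (k, l)) F"
    if "k < n - 1" "l < n - 1" for k l
    \<comment> \<open>Indices past the deleted row or column shift up by one; starting below
      \<open>n - 1\<close>, they stay below \<open>n\<close>.\<close>
    using that by (simp add: mat_delete_def) (intro conjI impI assms(3); linarith)
qed

text \<open>Nonvanishing of the determinant is an open condition.\<close>

lemma eventually_mat_injective:
  assumes "mat_injective n L"
    and "\<And>i j. i < n \<Longrightarrow> j < n \<Longrightarrow> ((\<lambda>t. A t i j) \<longlongrightarrow> L i j) F"
  shows "\<forall>\<^sub>F t in F. mat_injective n (A t)"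
proof -
  have "((\<lambda>t. det (mat n n (\<lambda>(i, j). A t i j))) \<longlongrightarrow> det (mat n n (\<lambda>(i, j). L i j))) F"
    by (rule tendsto_det[where n = n]) (use assms(2) in auto)
  then have "\<forall>\<^sub>F t in F. det (mat n n (\<lambda>(i, j). A t i j)) \<noteq> 0"
    by (rule tendsto_imp_eventually_ne) (use assms(1) mat_injective_iff_det in blast)
  then show ?thesis
    by (simp add: mat_injective_iff_det)
qed

text \<open>A matrix times its adjugate is the determinant times the identity; the adjugate is the
  transposed cofactor matrix, hence the index order in \<open>cofactor M k j\<close>.\<close>

lemma cramer_solution:
  fixes A :: "nat \<Rightarrow> nat \<Rightarrow> real" and n :: nat
  defines "M \<equiv> mat n n (\<lambda>(i, j). A i j)"
  assumes "det M \<noteq> 0" "i < n"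
  shows "(\<Sum>j<n. A i j * ((\<Sum>k<n. cofactor M k j * c k) / det M)) = c i"
proof -
  have carr: "M \<in> carrier_mat n n"
    by (simp add: M_def)
  have adj: "(\<Sum>j<n. A i j * cofactor M k j) = (if i = k then det M else 0)" if "k < n" for k
  proof -
    have "(M * adj_mat M) $$ (i, k) = (det M \<cdot>\<^sub>m 1\<^sub>m n) $$ (i, k)"
      by (simp add: adj_mat(2)[OF carr])
    then show ?thesis
      using assms(3) that
      by (simp add: M_def adj_mat_def scalar_prod_def lessThan_atLeast0 split: if_splits)
  qed
  have "(\<Sum>j<n. A i j * ((\<Sum>k<n. cofactor M k j * c k) / det M))
      = (\<Sum>k<n. \<Sum>j<n. A i j * cofactor M k j * c k / det M)"
    by (subst sum.swap) (simp add: sum_distrib_left sum_divide_distrib mult.assoc)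
  also have "\<dots> = (\<Sum>k<n. (\<Sum>j<n. A i j * cofactor M k j) * c k / det M)"
    by (simp add: sum_distrib_right sum_divide_distrib)
  also have "\<dots> = (\<Sum>k<n. if i = k then c k else 0)"
    using assms(2) by (intro sum.cong refl) (simp add: adj)
  finally show ?thesis
    using assms(3) by simp
qed

text \<open>Cramer's rule gives the solution as a quotient of polynomials in the entries, which
  passes to the limit because the limit determinant is nonzero. The system for \<open>A t\<close> is
  solved only eventually, since its determinant may vanish elsewhere.\<close>

lemma linear_system_tendsto:
  fixes A :: "'b \<Rightarrow> nat \<Rightarrow> nat \<Rightarrow> real"
  assumes "mat_injective n L"
    and lim: "\<And>i j. i < n \<Longrightarrow> j < n \<Longrightarrow> ((\<lambda>t. A t i j) \<longlongrightarrow> L i j) F"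
  shows "\<exists>w w0. (\<forall>\<^sub>F t in F. \<forall>i<n. (\<Sum>j<n. A t i j * w t j) = c i) \<and>
    (\<forall>i<n. (\<Sum>j<n. L i j * w0 j) = c i) \<and>
    (\<forall>j. ((\<lambda>t. w t j) \<longlongrightarrow> w0 j) F)"
proof -
  define M where "M t = mat n n (\<lambda>(i, j). A t i j)" for t
  define N where "N = mat n n (\<lambda>(i, j). L i j)"
  have N: "det N \<noteq> 0"
    using assms(1) by (simp add: mat_injective_iff_det N_def)
  have MN: "M t \<in> carrier_mat n n" "N \<in> carrier_mat n n"
    "\<And>i j. i < n \<Longrightarrow> j < n \<Longrightarrow> ((\<lambda>t. M t $$ (i, j)) \<longlongrightarrow> N $$ (i, j)) F" for t
    using lim by (auto simp: M_def N_def)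
  have inj: "\<forall>\<^sub>F t in F. mat_injective n (A t)"
    by (rule eventually_mat_injective[OF assms])
  show ?thesis
  proof (intro exI conjI)
    show "\<forall>\<^sub>F t in F. \<forall>i<n.
        (\<Sum>j<n. A t i j * ((\<Sum>k<n. cofactor (M t) k j * c k) / det (M t))) = c i"
      using inj
    proof eventually_elim
      case (elim t)
      then have "det (M t) \<noteq> 0"
        by (simp add: mat_injective_iff_det M_def)
      then show ?case
        unfolding M_def using cramer_solution by blast
    qed
    show "\<forall>i<n. (\<Sum>j<n. L i j * ((\<Sum>k<n. cofactor N k j * c k) / det N)) = c i"
      using N unfolding N_def using cramer_solution by blast
    show "\<forall>j. ((\<lambda>t. (\<Sum>k<n. cofactor (M t) k j * c k) / det (M t))
        \<longlongrightarrow> (\<Sum>k<n. cofactor N k j * c k) / det N) F"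
      by (intro allI tendsto_divide tendsto_sum tendsto_mult tendsto_const
          tendsto_cofactor[OF MN] tendsto_det[OF MN] N)
  qed
qed

section \<open>Fibres and the nondegeneracy condition\<close>

definition fibre_balanced :: "nat \<Rightarrow> nat \<Rightarrow> (nat \<Rightarrow> nat) \<Rightarrow> (nat \<Rightarrow> real) \<Rightarrow> bool" where
  "fibre_balanced m n f u \<longleftrightarrow> (\<forall>i<m. (\<Sum>b | b < n \<and> f b = i. u b) = 0)"

text \<open>These vectors are the annihilator of K under the standard pairing.\<close>

definition fibre_constant :: "nat \<Rightarrow> (nat \<Rightarrow> nat) \<Rightarrow> (nat \<Rightarrow> real) \<Rightarrow> bool" where
  "fibre_constant n f v \<longleftrightarrow> (\<forall>a<n. \<forall>a'<n. f a = f a' \<longrightarrow> v a = v a')"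

text \<open>Regrouping by fibres turns a row of the pullback of Z, applied to \<open>u\<close>, into
  a row of Z applied to the fibre sums of \<open>u\<close>.\<close>

lemma sum_fibres:
  fixes u g :: "nat \<Rightarrow> real"
  assumes "f ` {..<n} \<subseteq> {..<m}"
  shows "(\<Sum>b<n. g (f b) * u b) = (\<Sum>i<m. g i * (\<Sum>b | b < n \<and> f b = i. u b))"
proof -
  have "(\<Sum>b<n. g (f b) * u b) = (\<Sum>i<m. \<Sum>b | b \<in> {..<n} \<and> f b = i. g (f b) * u b)"
    using assms by (intro sum.group[symmetric]) auto
  then show ?thesis
    by (simp add: sum_distrib_left)
qed

text \<open>A vector annihilates K exactly when it is constant on the fibres, so the vectors
  \<open>u\<close> in the premise form the radical of the bilinear form N on K. This formulation
  needs no basis of K.\<close>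

definition nondegenerate ::
  "nat \<Rightarrow> nat \<Rightarrow> (nat \<Rightarrow> nat) \<Rightarrow> (nat \<Rightarrow> nat \<Rightarrow> real) \<Rightarrow> (nat \<Rightarrow> nat \<Rightarrow> real) \<Rightarrow> bool" where
  "nondegenerate m n f dX D \<longleftrightarrow>
     (\<forall>u. fibre_balanced m n f u \<and>
        fibre_constant n f (\<lambda>a. \<Sum>b<n. sim dX (f a) (f b) * D a b * u b)
        \<longrightarrow> (\<forall>b<n. u b = 0))"

text \<open>The rows outside the section p are t-derivatives at 0 of differences of two rows of the
similarity matrix. The dX terms cancel because f (p (f a)) = f a.\<close>
definition limit_matrix ::
  "(nat \<Rightarrow> nat) \<Rightarrow> (nat \<Rightarrow> nat) \<Rightarrow> (nat \<Rightarrow> nat \<Rightarrow> real) \<Rightarrow> (nat \<Rightarrow> nat \<Rightarrow> real) \<Rightarrow>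
     nat \<Rightarrow> nat \<Rightarrow> real" where
  "limit_matrix f p dX D a b =
     (if a = p (f a) then sim dX (f a) (f b)
      else sim dX (f a) (f b) * (D (p (f a)) b - D a b))"

text \<open>The two matrices of conditions have the same solutions. Rows on the section apply Z to
  the fibre sums, and Z is injective, so they vanish exactly for \<open>u\<close> in K. The
  remaining rows compare N \<open>u\<close> at \<open>a\<close> and at \<open>p (f a)\<close>, so
  they vanish exactly when N \<open>u\<close> is constant on the fibres.\<close>

lemma nondegenerate_iff_limit_matrix:
  assumes f: "f ` {..<n} \<subseteq> {..<m}"
    and p: "\<And>i. i < m \<Longrightarrow> p i < n \<and> f (p i) = i"
    and X: "mat_injective m (sim dX)"
  shows "nondegenerate m n f dX D \<longleftrightarrow> mat_injective n (limit_matrix f p dX D)"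
proof -
  have "(\<forall>a<n. (\<Sum>b<n. limit_matrix f p dX D a b * u b) = 0) \<longleftrightarrow>
      fibre_balanced m n f u \<and>
      fibre_constant n f (\<lambda>a. \<Sum>b<n. sim dX (f a) (f b) * D a b * u b)" (is "?L \<longleftrightarrow> ?B \<and> ?C") for u
  proof -
    define v where "v a = (\<Sum>b<n. sim dX (f a) (f b) * D a b * u b)" for a
    have base: "(\<Sum>b<n. limit_matrix f p dX D a b * u b)
        = (\<Sum>j<m. sim dX (f a) j * (\<Sum>b | b < n \<and> f b = j. u b))" if "a = p (f a)" for a
      using that sum_fibres[OF f, of "sim dX (f a)" u] by (simp add: limit_matrix_def)
    have nonbase: "(\<Sum>b<n. limit_matrix f p dX D a b * u b) = v (p (f a)) - v a"
      if "a \<noteq> p (f a)" "a < n" for a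
    proof -
      have "f (p (f a)) = f a"
        using that f p by auto
      then show ?thesis
        using that by (simp add: limit_matrix_def v_def sum_subtractf[symmetric] algebra_simps)
    qed
    show ?thesis
    proof
      assume L: ?L
      have "(\<Sum>j<m. sim dX i j * (\<Sum>b | b < n \<and> f b = j. u b)) = 0" if "i < m" for i
        using p[OF that] L base[of "p i"] by simp
      then have ?B
        using X[unfolded mat_injective_def, THEN spec, of "\<lambda>j. \<Sum>b | b < n \<and> f b = j. u b"]
        unfolding fibre_balanced_def by simp
      \<comment> \<open>Constancy on a fibre follows from comparing each of its points with its
        section point.\<close>
      moreover have "v a = v (p (f a))" if "a < n" for a
        using nonbase[of a] L that by (cases "a = p (f a)") auto
      then have ?C
        unfolding fibre_constant_def v_def[symmetric] by metis
      ultimately show "?B \<and> ?C" ..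
    next
      assume BC: "?B \<and> ?C"
      have "(\<Sum>b<n. limit_matrix f p dX D a b * u b) = 0" if "a < n" for a
      proof (cases "a = p (f a)")
        case True
        then show ?thesis
          using base[OF True] BC by (simp add: fibre_balanced_def)
      next
        case False
        have "p (f a) < n" "f (p (f a)) = f a"
          using that f p by auto
        with BC[THEN conjunct2, unfolded fibre_constant_def v_def[symmetric], rule_format, of "p (f a)" a]
        have "v (p (f a)) = v a"
          using that by simp
        then show ?thesis
          using nonbase[OF False that] by simp
      qed
      then show ?L by blast
    qed
  qed
  then show ?thesis
    unfolding nondegenerate_def mat_injective_def by simp
qed

section \<open>Perturbation by the discrete metric\<close>

text \<open>The bounds on \<open>a\<close> and \<open>b\<close> preserve the zero entries outside
  the index range that \<open>line_reps\<close> demands.\<close>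

definition shift_dist :: "nat \<Rightarrow> real \<Rightarrow> (nat \<Rightarrow> nat \<Rightarrow> real) \<Rightarrow> nat \<Rightarrow> nat \<Rightarrow> real" where
  "shift_dist n s D a b = (if a < n \<and> b < n \<and> a \<noteq> b then D a b + s else D a b)"

lemma is_metric_shift_dist:
  assumes "is_metric n D" "0 \<le> s"
  shows "is_metric n (shift_dist n s D)"
proof -
  have D: "0 \<le> D i j" "D i j = 0 \<longleftrightarrow> i = j" "D i j = D j i" if "i < n" "j < n" for i j
    using assms(1) that by (auto simp: is_metric_def)
  have tri: "D i k \<le> D i j + D j k" if "i < n" "j < n" "k < n" for i j k
    using assms(1) that by (auto simp: is_metric_def)
  show ?thesis
    unfolding is_metric_def
  proof (intro conjI allI impI)
    fix i j assume ij: "i < n" "j < n"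
    show "0 \<le> shift_dist n s D i j" "shift_dist n s D i j = shift_dist n s D j i"
      using D[OF ij] ij assms(2) by (auto simp: shift_dist_def)
    show "shift_dist n s D i j = 0 \<longleftrightarrow> i = j"
      using D[OF ij] ij assms(2) by (auto simp: shift_dist_def)
  next
    fix i j k assume ijk: "i < n" "j < n" "k < n"
    have "D i i = 0"
      using D(2) ijk by blast
    then show "shift_dist n s D i k \<le> shift_dist n s D i j + shift_dist n s D j k"
      using tri[OF ijk] D(1)[of i j] D(1)[of j i] ijk assms(2) by (auto simp: shift_dist_def)
  qed
qed

text \<open>If the shift by \<open>s\<close> is degenerate, some nonzero \<open>u\<close> in K makes
  N \<open>u\<close> - \<open>s\<close> \<open>u\<close> constant on the fibres. Subtracting fibre
  averages kills that constant and leaves \<open>s\<close> \<open>u\<close> unchanged, so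
  \<open>s\<close> is an eigenvalue of a matrix independent of \<open>s\<close>.\<close>

lemma finite_degenerate_shifts:
  assumes f: "f ` {..<n} \<subseteq> {..<m}" and X: "\<And>i. i < m \<Longrightarrow> dX i i = 0"
  shows "finite {s. \<not> nondegenerate m n f dX (shift_dist n s D)}"
proof -
  define N where "N a b = sim dX (f a) (f b) * D a b" for a b
  define fib where "fib a = {a'. a' < n \<and> f a' = f a}" for a
  \<comment> \<open>N followed by the projection onto K along the vectors constant on the
    fibres.\<close>
  define Q where "Q a b = N a b - (\<Sum>a'\<in>fib a. N a' b) / card (fib a)" for a b
  define M where "M = mat n n (\<lambda>(a, b). Q a b)"
  have M: "M \<in> carrier_mat n n"
    by (simp add: M_def)
  have "eigenvalue M s" if "\<not> nondegenerate m n f dX (shift_dist n s D)" for s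
  proof -
    obtain u c where bal: "fibre_balanced m n f u"
      and const: "fibre_constant n f
        (\<lambda>a. \<Sum>b<n. sim dX (f a) (f b) * shift_dist n s D a b * u b)"
      and c: "c < n" "u c \<noteq> 0"
      using \<open>\<not> nondegenerate m n f dX (shift_dist n s D)\<close> unfolding nondegenerate_def by auto
    define v where "v a = (\<Sum>b<n. sim dX (f a) (f b) * shift_dist n s D a b * u b)" for a
    have v: "v a = (\<Sum>b<n. N a b * u b) - s * u a" if "a < n" for a
    proof -
      have fa: "f a < m"
        using f that by auto
      have "v a = (\<Sum>b<n. N a b * u b + s * (sim dX (f a) (f b) * u b)
          - (if b = a then s * u b else 0))"
        unfolding v_def using that X[OF fa]
        by (intro sum.cong) (auto simp: shift_dist_def N_def sim_def algebra_simps)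
      also have "\<dots> = (\<Sum>b<n. N a b * u b) + s * (\<Sum>b<n. sim dX (f a) (f b) * u b) - s * u a"
        using that by (simp add: sum.distrib sum_subtractf sum_distrib_left)
      also have "(\<Sum>b<n. sim dX (f a) (f b) * u b) = 0"
        using bal by (simp add: sum_fibres[OF f] fibre_balanced_def)
      finally show ?thesis by simp
    qed
    have "(\<Sum>b<n. Q a b * u b) = s * u a" if a: "a < n" for a
    proof -
      \<comment> \<open>The point \<open>a\<close> lies in its own fibre, so the average is a
        genuine division.\<close>
      have card: "card (fib a) > 0"
        using a by (auto simp: fib_def card_gt_0_iff)
      have "(\<Sum>b<n. Q a b * u b)
          = (\<Sum>b<n. N a b * u b) - (\<Sum>b<n. \<Sum>a'\<in>fib a. N a' b * u b / card (fib a))"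
        by (simp add: Q_def left_diff_distrib sum_subtractf sum_distrib_right sum_divide_distrib)
      also have "(\<Sum>b<n. \<Sum>a'\<in>fib a. N a' b * u b / card (fib a))
          = (\<Sum>a'\<in>fib a. \<Sum>b<n. N a' b * u b) / card (fib a)"
        by (subst sum.swap) (simp add: sum_divide_distrib)
      also have "(\<Sum>a'\<in>fib a. \<Sum>b<n. N a' b * u b) = (\<Sum>a'\<in>fib a. v a + s * u a')"
      proof (intro sum.cong refl)
        fix a' assume "a' \<in> fib a"
        then have a': "a' < n" "f a' = f a"
          by (auto simp: fib_def)
        then have "v a' = v a"
          using const a unfolding fibre_constant_def v_def[symmetric] by blast
        then show "(\<Sum>b<n. N a' b * u b) = v a + s * u a'"
          using v[OF a'(1)] by simp
      qed
      also have "\<dots> = card (fib a) * v a"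
      proof -
        have "f a < m"
          using f a by auto
        then have "(\<Sum>a'\<in>fib a. u a') = 0"
          using bal by (simp add: fib_def fibre_balanced_def)
        then show ?thesis
          by (simp add: sum.distrib sum_distrib_left[symmetric])
      qed
      finally show ?thesis
        using v[OF a] card by simp
    qed
    then have "eigenvector M (vec n u) s"
      using c by (auto simp: eigenvector_def M_def vec_eq_iff scalar_prod_def lessThan_atLeast0)
    then show ?thesis
      unfolding eigenvalue_def by blast
  qed
  then have "{s. \<not> nondegenerate m n f dX (shift_dist n s D)} \<subseteq> {s. poly (char_poly M) s = 0}"
    using eigenvalue_root_char_poly[OF M] by blast
  \<comment> \<open>The characteristic polynomial is monic, hence nonzero and with finitely many
    roots.\<close>
  moreover have "char_poly M \<noteq> 0"
    using degree_monic_char_poly[OF M] by auto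
  ultimately show ?thesis
    using poly_roots_finite finite_subset by blast
qed

section \<open>Openness of nondegeneracy\<close>

text \<open>The entries of the limit matrix depend continuously on \<open>D\<close>, and
  invertibility is open. If no radius worked, the radii 1/(k+1) would give degenerate matrices
  \<open>D' k\<close> converging to \<open>D\<close>, contradicting
  \<open>eventually_mat_injective\<close> along that sequence.\<close>

lemma nondegenerate_open:
  assumes f: "f ` {..<n} = {..<m}" and X: "mat_injective m (sim dX)"
    and D: "nondegenerate m n f dX D"
  shows "\<exists>e>0. \<forall>D'. (\<forall>i<n. \<forall>j<n. \<bar>D' i j - D i j\<bar> < e) \<longrightarrow> nondegenerate m n f dX D'"
proof (rule ccontr)
  assume contra: "\<not> ?thesis"
  have "\<exists>D'. (\<forall>i<n. \<forall>j<n. \<bar>D' i j - D i j\<bar> < inverse (real (Suc k)))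
      \<and> \<not> nondegenerate m n f dX D'" for k
  proof -
    have "0 < inverse (real (Suc k))"
      by simp
    with contra show ?thesis
      by blast
  qed
  then obtain D' where D':
    "\<And>k i j. i < n \<Longrightarrow> j < n \<Longrightarrow> \<bar>D' k i j - D i j\<bar> < inverse (real (Suc k))"
    "\<And>k. \<not> nondegenerate m n f dX (D' k)"
    by metis
  have lim: "(\<lambda>k. D' k i j) \<longlonglongrightarrow> D i j" if "i < n" "j < n" for i j
  proof -
    have "(\<lambda>k. D' k i j - D i j) \<longlonglongrightarrow> 0"
      by (rule tendsto_rabs_zero_cancel, rule tendsto_sandwich[OF _ _ tendsto_const
            LIMSEQ_inverse_real_of_nat])
        (use D'(1)[OF that] in \<open>auto intro!: always_eventually less_imp_le\<close>)
    then show ?thesis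
      by (simp add: LIM_zero_iff)
  qed
  define p where "p = inv_into {..<n} f"
  have p: "p i < n \<and> f (p i) = i" if "i < m" for i
    using that f inv_into_into[of i f "{..<n}"] f_inv_into_f[of i f "{..<n}"] by (simp add: p_def)
  note iff = nondegenerate_iff_limit_matrix[OF equalityD1[OF f] p X]
  have "\<forall>\<^sub>F k in sequentially. mat_injective n (limit_matrix f p dX (D' k))"
  proof (rule eventually_mat_injective)
    show "mat_injective n (limit_matrix f p dX D)"
      using D iff by blast
    show "(\<lambda>k. limit_matrix f p dX (D' k) a b) \<longlonglongrightarrow> limit_matrix f p dX D a b"
      if "a < n" "b < n" for a b
    proof -
      have "p (f a) < n"
        using p f that by auto
      then show ?thesis
        using that by (auto simp: limit_matrix_def intro!: tendsto_intros lim)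
    qed
  qed
  then show False
    using D'(2) iff by (auto simp: eventually_sequentially)
qed

section \<open>Magnitude, its limit along a line, and invertibility of the similarity matrix\<close>

text \<open>For weightings \<open>w\<close> and \<open>w'\<close>, evaluating the symmetric bilinear
  form of the similarity matrix at \<open>w'\<close> and \<open>w\<close> in two ways yields both
  totals. Hence the choice in \<open>magnitude\<close> is determined even for a singular similarity
  matrix.\<close>

lemma magnitude_eq:
  assumes sym: "\<And>i j. i < n \<Longrightarrow> j < n \<Longrightarrow> D i j = D j i" and w: "is_weighting n D w"
  shows "magnitude n D = (\<Sum>i<n. w i)"
proof -
  have unique: "(\<Sum>i<n. w' i) = (\<Sum>i<n. w i)" if w': "is_weighting n D w'" for w'
  proof -
    have "(\<Sum>i<n. w' i) = (\<Sum>i<n. \<Sum>j<n. w' i * (sim D i j * w j))"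
      using w by (simp add: is_weighting_def sum_distrib_left[symmetric])
    also have "\<dots> = (\<Sum>j<n. \<Sum>i<n. w' i * (sim D i j * w j))"
      by (rule sum.swap)
    also have "\<dots> = (\<Sum>j<n. \<Sum>i<n. w j * (sim D j i * w' i))"
      using sym by (intro sum.cong refl) (simp add: sim_def)
    also have "\<dots> = (\<Sum>j<n. w j)"
      using w' by (simp add: is_weighting_def sum_distrib_left[symmetric])
    finally show ?thesis .
  qed
  show ?thesis
    unfolding magnitude_def
  proof (rule some_equality)
    show "\<exists>w'. is_weighting n D w' \<and> (\<Sum>i<n. w i) = (\<Sum>i<n. w' i)"
      using w by blast
    show "s = (\<Sum>i<n. w i)" if "\<exists>w'. is_weighting n D w' \<and> s = (\<Sum>i<n. w' i)" for s
      using that unique by metis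
  qed
qed

text \<open>The two exponentials agree at t = 0, so the quotient tends to the derivative of their
  difference there, in which the contributions of \<open>z\<close> cancel.\<close>

lemma tendsto_exp_interpolation_quotient:
  fixes x y z :: real
  shows "((\<lambda>t. (exp (- (t * x + (1 - t) * z)) - exp (- (t * y + (1 - t) * z))) / t)
    \<longlongrightarrow> exp (- z) * (y - x)) (at_right 0)"
proof -
  have "((\<lambda>t. exp (- (t * x + (1 - t) * z)) - exp (- (t * y + (1 - t) * z)))
      has_real_derivative exp (- z) * (y - x)) (at 0 within {0<..})"
    by (auto intro!: derivative_eq_intros simp: algebra_simps)
  then show ?thesis
    by (simp add: has_field_derivative_iff)
qed

text \<open>The first conclusion gives meaning to the second, since \<open>magnitude\<close> is an
  arbitrary value when there is no weighting.\<close>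

lemma magnitude_tendsto:
  fixes dX D :: "nat \<Rightarrow> nat \<Rightarrow> real" and f :: "nat \<Rightarrow> nat"
  defines "Y \<equiv> \<lambda>t a b. t * D a b + (1 - t) * dX (f a) (f b)"
  assumes f: "f ` {..<n} = {..<m}" and inj: "mat_injective m (sim dX)"
    and X: "\<And>i j. i < m \<Longrightarrow> j < m \<Longrightarrow> dX i j = dX j i"
    and D: "\<And>a b. a < n \<Longrightarrow> b < n \<Longrightarrow> D a b = D b a"
    and nondeg: "nondegenerate m n f dX D"
  shows "\<forall>\<^sub>F t in at_right 0. has_magnitude n (Y t)"
    and "((\<lambda>t. magnitude n (Y t)) \<longlongrightarrow> magnitude m dX) (at_right 0)"
proof -
  note f' = equalityD1[OF f]
  define p where "p = inv_into {..<n} f"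
  have p: "p i < n \<and> f (p i) = i" if "i < m" for i
    using that f inv_into_into[of i f "{..<n}"] f_inv_into_f[of i f "{..<n}"] by (simp add: p_def)
  have pf: "p (f a) < n" "f (p (f a)) = f a" if "a < n" for a
    using p f that by auto
  define A where "A t a b =
    (if a = p (f a) then sim (Y t) a b else (sim (Y t) a b - sim (Y t) (p (f a)) b) / t)" for t a b
  \<comment> \<open>The right-hand side undergoes the same row operation: 1 on the section, (1 - 1)
    / t = 0 elsewhere.\<close>
  define c :: "nat \<Rightarrow> real" where "c a = (if a = p (f a) then 1 else 0)" for a
  have L: "mat_injective n (limit_matrix f p dX D)"
    using nondeg nondegenerate_iff_limit_matrix[OF f' p inj] by blast
  have lim: "((\<lambda>t. A t a b) \<longlongrightarrow> limit_matrix f p dX D a b) (at_right 0)" if "a < n" "b < n" for a b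
  proof (cases "a = p (f a)")
    case True
    have "((\<lambda>t. exp (- (t * D a b + (1 - t) * dX (f a) (f b))))
        \<longlongrightarrow> exp (- (0 * D a b + (1 - 0) * dX (f a) (f b)))) (at_right 0)"
      by (intro tendsto_intros)
    then show ?thesis
      using True by (simp add: A_def Y_def sim_def limit_matrix_def)
  next
    case False
    then show ?thesis
      using tendsto_exp_interpolation_quotient[of "D a b" "dX (f a) (f b)" "D (p (f a)) b"] pf that
      by (simp add: A_def Y_def sim_def limit_matrix_def)
  qed
  have "\<exists>w w0. (\<forall>\<^sub>F t in at_right 0. \<forall>a<n. (\<Sum>b<n. A t a b * w t b) = c a) \<and>
      (\<forall>a<n. (\<Sum>b<n. limit_matrix f p dX D a b * w0 b) = c a) \<and>
      (\<forall>b. ((\<lambda>t. w t b) \<longlongrightarrow> w0 b) (at_right 0))"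
    by (rule linear_system_tendsto[OF L lim])
  then obtain w w0 where w: "\<forall>\<^sub>F t in at_right 0. \<forall>a<n. (\<Sum>b<n. A t a b * w t b) = c a"
    and w0: "\<forall>a<n. (\<Sum>b<n. limit_matrix f p dX D a b * w0 b) = c a"
    and w_lim: "\<And>b. ((\<lambda>t. w t b) \<longlongrightarrow> w0 b) (at_right 0)"
    by blast
  \<comment> \<open>Undoing the row operation multiplies by t, which must be nonzero.\<close>
  have "\<forall>\<^sub>F t in at_right (0::real). t > 0"
    by (simp add: eventually_at_right_less)
  with w have weighting: "\<forall>\<^sub>F t in at_right 0. is_weighting n (Y t) (w t)"
  proof eventually_elim
    case (elim t)
    have base: "(\<Sum>b<n. sim (Y t) (p (f a)) b * w t b) = 1" if "a < n" for a
      using elim(1)[rule_format, OF pf(1)[OF that]] pf[OF that] by (simp add: A_def c_def)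
    have "(\<Sum>b<n. sim (Y t) a b * w t b) = 1" if "a < n" for a
    proof (cases "a = p (f a)")
      case True
      then show ?thesis
        using base[OF that] by simp
    next
      case False
      have "(\<Sum>b<n. A t a b * w t b)
          = ((\<Sum>b<n. sim (Y t) a b * w t b) - (\<Sum>b<n. sim (Y t) (p (f a)) b * w t b)) / t"
        using False
        by (simp add: A_def sum_subtractf[symmetric] sum_divide_distrib left_diff_distrib)
      then show ?thesis
        using elim False that base[OF that] by (auto simp: c_def)
    qed
    then show ?case
      by (simp add: is_weighting_def)
  qed
  then show "\<forall>\<^sub>F t in at_right 0. has_magnitude n (Y t)"
    by eventually_elim (auto simp: has_magnitude_def)
  have Ysym: "Y t a b = Y t b a" if "a < n" "b < n" for t a b
    using that f' X[of "f a" "f b"] D[of a b] by (auto simp: Y_def)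
  have "\<forall>\<^sub>F t in at_right 0. (\<Sum>b<n. w t b) = magnitude n (Y t)"
    using weighting
    by eventually_elim (use magnitude_eq Ysym in simp)
  moreover have "((\<lambda>t. \<Sum>b<n. w t b) \<longlongrightarrow> (\<Sum>b<n. w0 b)) (at_right 0)"
    by (intro tendsto_sum w_lim)
  moreover have "(\<Sum>b<n. w0 b) = magnitude m dX"
  proof -
    define x where "x i = (\<Sum>b | b < n \<and> f b = i. w0 b)" for i
    \<comment> \<open>Row \<open>p i\<close> of the limit system is row \<open>i\<close> of Z
      applied to the fibre sums, with right-hand side 1.\<close>
    have "(\<Sum>j<m. sim dX i j * x j) = 1" if "i < m" for i
      using w0[rule_format, of "p i"] p[OF that] sum_fibres[OF f', of "sim dX i" w0]
      by (simp add: limit_matrix_def c_def x_def)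
    then have "magnitude m dX = (\<Sum>i<m. x i)"
      by (intro magnitude_eq) (auto simp: X is_weighting_def)
    then show ?thesis
      using sum_fibres[OF f', of "\<lambda>_. 1" w0] by (simp add: x_def)
  qed
  ultimately show "((\<lambda>t. magnitude n (Y t)) \<longlongrightarrow> magnitude m dX) (at_right 0)"
    using Lim_transform_eventually by metis
qed

text \<open>A left inverse \<open>W\<close> gives \<open>u\<close> = \<open>W\<close> (Z
  \<open>u\<close>) = 0.\<close>

lemma sim_invertible_imp_mat_injective:
  assumes "sim_invertible m dX"
  shows "mat_injective m (sim dX)"
  unfolding mat_injective_def
proof (intro allI impI)
  fix u i
  assume u: "\<forall>i<m. (\<Sum>j<m. sim dX i j * u j) = 0" and i: "i < m"
  obtain W where W: "\<forall>i<m. \<forall>j<m. (\<Sum>k<m. W i k * sim dX k j) = (if i = j then 1 else 0)"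
    using assms unfolding sim_invertible_def by blast
  have "u i = (\<Sum>j<m. (if i = j then 1 else 0) * u j)"
    using i by (simp add: if_distrib[of "\<lambda>x. x * _"] cong: if_cong)
  also have "\<dots> = (\<Sum>j<m. (\<Sum>k<m. W i k * sim dX k j) * u j)"
    using W i by (intro sum.cong) auto
  also have "\<dots> = (\<Sum>k<m. W i k * (\<Sum>j<m. sim dX k j * u j))"
    by (simp add: sum_distrib_left sum_distrib_right mult.assoc) (rule sum.swap)
  finally show "u i = 0"
    using u by simp
qed

section \<open>Block maps and equivalence of lines\<close>

text \<open>Block \<open>i\<close> is nonempty, so it contains the point numbered by the total size
  of the preceding blocks.\<close>

lemma blk_image:
  assumes "length rs = m" "\<forall>r\<in>set rs. 1 \<le> r"
  shows "blk rs ` {..<sum_list rs} = {..<m}"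
proof (intro equalityI subsetI)
  fix i assume "i \<in> blk rs ` {..<sum_list rs}"
  then obtain a where a: "a < sum_list rs" "i = blk rs a"
    by auto
  \<comment> \<open>A point exists, so there is a block, and \<open>m - 1\<close> is a true
    predecessor: its prefix is the whole list.\<close>
  then have "m > 0"
    using assms(1) by (cases m) auto
  then have "blk rs a \<le> m - 1"
    unfolding blk_def using a(1) assms(1) by (intro Least_le) simp
  then show "i \<in> {..<m}"
    using a \<open>m > 0\<close> by simp
next
  fix i assume "i \<in> {..<m}"
  then have i: "i < length rs"
    using assms(1) by simp
  let ?a = "sum_list (take i rs)"
  have mono: "sum_list (take k rs) \<le> sum_list (take l rs)" if "k \<le> l" for k l
    using that by (auto simp: le_iff_add take_add)
  have step: "?a < sum_list (take (Suc i) rs)"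
    using i assms(2) by (simp add: take_Suc_conv_app_nth Suc_le_eq)
  have "blk rs ?a = i"
    unfolding blk_def
  proof (rule Least_equality)
    show "?a < sum_list (take (Suc i) rs)"
      by (rule step)
    show "i \<le> j" if "?a < sum_list (take (Suc j) rs)" for j
      using that mono[of "Suc j" i] by (metis leD not_less_eq_eq)
  qed
  moreover have "?a < sum_list rs"
    using step mono[of "Suc i" "length rs"] i by simp
  ultimately show "i \<in> blk rs ` {..<sum_list rs}"
    by force
qed

text \<open>A vector in the radical for \<open>D'\<close> is pulled back along \<open>h\<close>.
  Since \<open>k\<close> is injective, \<open>h\<close> carries the fibre over \<open>i\<close> onto
  the fibre over \<open>k i\<close>, and since \<open>k\<close> is an isometry the similarities
  agree; hence \<open>u \<circ> h\<close> lies in the radical for \<open>D\<close>.\<close>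

lemma nondegenerate_transfer:
  assumes f: "f ` {..<n} \<subseteq> {..<m}"
    and k: "is_isometry m dX k" and h: "bij_betw h {0..<n} {0..<n'}"
    and D': "\<forall>a<n. \<forall>b<n. D' (h a) (h b) = D a b"
    and kf: "\<forall>a<n. k (f a) = f' (h a)"
    and nondeg: "nondegenerate m n f dX D"
  shows "nondegenerate m n' f' dX D'"
  unfolding nondegenerate_def
proof (intro allI impI, elim conjE)
  fix u b'
  assume bal: "fibre_balanced m n' f' u"
    and const: "fibre_constant n' f' (\<lambda>a. \<Sum>b<n'. sim dX (f' a) (f' b) * D' a b * u b)"
    and b': "b' < n'"
  have k_inj: "inj_on k {0..<m}" and k_lt: "\<And>i. i < m \<Longrightarrow> k i < m"
    and k_dist: "\<And>i j. i < m \<Longrightarrow> j < m \<Longrightarrow> dX (k i) (k j) = dX i j"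
    using k by (auto simp: is_isometry_def bij_betw_def)
  have h_lt: "h a < n'" if "a < n" for a
    using h that by (auto simp: bij_betw_def)
  have h_onto: "\<exists>a<n. b = h a" if "b < n'" for b
    using h that by (metis atLeastLessThan_iff bij_betw_imp_surj_on imageE zero_le)
  have f_lt: "f a < m" if "a < n" for a
    using f that by auto
  have "fibre_balanced m n f (u \<circ> h)"
    unfolding fibre_balanced_def
  proof (intro allI impI)
    fix i assume i: "i < m"
    have eq: "f b = i \<longleftrightarrow> f' (h b) = k i" if "b < n" for b
      using kf that inj_on_eq_iff[OF k_inj, of "f b" i] f_lt[OF that] i by auto
    have "bij_betw h {b. b < n \<and> f b = i} {b. b < n' \<and> f' b = k i}"
    proof (rule bij_betw_subset[OF h])
      show "{b. b < n \<and> f b = i} \<subseteq> {0..<n}"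
        by auto
      show "h ` {b. b < n \<and> f b = i} = {b. b < n' \<and> f' b = k i}"
      proof (intro equalityI subsetI)
        fix c assume "c \<in> {b. b < n' \<and> f' b = k i}"
        then obtain b where "b < n" "c = h b" "f' c = k i"
          using h_onto by blast
        then show "c \<in> h ` {b. b < n \<and> f b = i}"
          using eq by blast
      qed (use h_lt eq in blast)
    qed
    then have "(\<Sum>b | b < n \<and> f b = i. u (h b)) = (\<Sum>b | b < n' \<and> f' b = k i. u b)"
      by (rule sum.reindex_bij_betw)
    then show "(\<Sum>b | b < n \<and> f b = i. (u \<circ> h) b) = 0"
      using bal k_lt[OF i] by (simp add: fibre_balanced_def)
  qed
  moreover have "fibre_constant n f (\<lambda>a. \<Sum>b<n. sim dX (f a) (f b) * D a b * (u \<circ> h) b)"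
  proof -
    define v where "v a = (\<Sum>b<n'. sim dX (f' a) (f' b) * D' a b * u b)" for a
    have v: "(\<Sum>b<n. sim dX (f a) (f b) * D a b * (u \<circ> h) b) = v (h a)" if a: "a < n" for a
    proof -
      have "sim dX (f a) (f b) * D a b * (u \<circ> h) b
          = sim dX (f' (h a)) (f' (h b)) * D' (h a) (h b) * u (h b)" if "b < n" for b
      proof -
        have "sim dX (f' (h a)) (f' (h b)) = sim dX (f a) (f b)"
          using k_dist[OF f_lt[OF a] f_lt[OF that]] kf a that by (simp add: sim_def)
        then show ?thesis
          using D' a that by simp
      qed
      then have "(\<Sum>b<n. sim dX (f a) (f b) * D a b * (u \<circ> h) b)
          = (\<Sum>b\<in>{0..<n}. sim dX (f' (h a)) (f' (h b)) * D' (h a) (h b) * u (h b))"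
        by (intro sum.cong) auto
      also have "\<dots> = (\<Sum>b\<in>{0..<n'}. sim dX (f' (h a)) (f' b) * D' (h a) b * u b)"
        by (rule sum.reindex_bij_betw[OF h])
      finally show ?thesis
        by (simp add: v_def lessThan_atLeast0)
    qed
    have v_eq: "v (h a) = v (h a')" if "a < n" "a' < n" "f a = f a'" for a a'
    proof -
      have "f' (h a) = f' (h a')"
        using kf that by metis
      then show ?thesis
        using const h_lt that unfolding fibre_constant_def v_def[symmetric] by blast
    qed
    show ?thesis
      unfolding fibre_constant_def
    proof (intro allI impI)
      fix a a' assume a: "a < n" "a' < n" "f a = f a'"
      show "(\<Sum>b<n. sim dX (f a) (f b) * D a b * (u \<circ> h) b)
          = (\<Sum>b<n. sim dX (f a') (f b) * D a' b * (u \<circ> h) b)"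
        by (rule trans[OF v[OF a(1)] trans[OF v_eq[OF a] v[OF a(2), symmetric]]])
    qed
  qed
  ultimately have zero: "\<forall>b<n. (u \<circ> h) b = 0"
    using nondeg unfolding nondegenerate_def by blast
  obtain b where "b < n" "b' = h b"
    using h_onto b' by blast
  then show "u b' = 0"
    using zero by simp
qed

lemma line_equiv_refl:
  assumes "x \<in> line_reps m"
  shows "(x, x) \<in> line_equiv m dX"
proof -
  have "is_isometry m dX id" "bij_betw id {0..<n} {0..<n}" for n :: nat
    by (auto simp: is_isometry_def)
  then show ?thesis
    using assms unfolding line_equiv_def by (auto intro!: exI[of _ id])
qed

text \<open>The inverses of \<open>h\<close> and \<open>k\<close> witness the reversed
  relation.\<close>

lemma line_equiv_sym:
  assumes "(x, y) \<in> line_equiv m dX"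
  shows "(y, x) \<in> line_equiv m dX"
proof -
  obtain rs D rs' D' where xy: "x = (rs, D)" "y = (rs', D')"
    by (cases x, cases y)
  define n n' where "n = sum_list rs" and "n' = sum_list rs'"
  from assms obtain h k where
    reps: "(rs, D) \<in> line_reps m" "(rs', D') \<in> line_reps m"
    and k: "bij_betw k {0..<m} {0..<m}" and kX: "\<And>i j. i < m \<Longrightarrow> j < m \<Longrightarrow> dX (k i) (k j) = dX i j"
    and h: "bij_betw h {0..<n} {0..<n'}"
    and hD: "\<And>a b. a < n \<Longrightarrow> b < n \<Longrightarrow> D' (h a) (h b) = D a b"
    and kh: "\<And>a. a < n \<Longrightarrow> k (blk rs a) = blk rs' (h a)"
    unfolding line_equiv_def is_isometry_def xy n_def n'_def by auto
  let ?k = "inv_into {0..<m} k" and ?h = "inv_into {0..<n} h"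
  have k': "?k i < m \<and> k (?k i) = i" if "i < m" for i
    using k that bij_betw_inv_into_right[OF k] bij_betw_apply[OF bij_betw_inv_into[OF k]] by simp
  have h': "?h a < n \<and> h (?h a) = a" if "a < n'" for a
    using h that bij_betw_inv_into_right[OF h] bij_betw_apply[OF bij_betw_inv_into[OF h]] by simp
  have "is_isometry m dX ?k"
    unfolding is_isometry_def using bij_betw_inv_into[OF k] k' kX by metis
  moreover have "bij_betw ?h {0..<n'} {0..<n}"
    by (rule bij_betw_inv_into[OF h])
  moreover have "D (?h a) (?h b) = D' a b" if "a < n'" "b < n'" for a b
    using hD[of "?h a" "?h b"] h' that by simp
  moreover have "?k (blk rs' a) = blk rs (?h a)" if a: "a < n'" for a
  proof -
    \<comment> \<open>The inverse of \<open>k\<close> cancels \<open>k\<close> only below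
      \<open>m\<close>, so the block index must be bounded first.\<close>
    have "blk rs ` {..<n} = {..<m}"
      unfolding n_def by (rule blk_image) (use reps in \<open>auto simp: line_reps_def\<close>)
    then have "blk rs (?h a) < m"
      using h'[OF a] by auto
    then show ?thesis
      using kh[of "?h a"] h'[OF a] bij_betw_inv_into_left[OF k, of "blk rs (?h a)"] by simp
  qed
  ultimately show ?thesis
    unfolding line_equiv_def xy using reps n_def n'_def by blast
qed

section \<open>Nondegenerate representatives: saturation, openness and density\<close>

definition nondegenerate_reps ::
  "nat \<Rightarrow> (nat \<Rightarrow> nat \<Rightarrow> real) \<Rightarrow> (nat list \<times> (nat \<Rightarrow> nat \<Rightarrow> real)) set" where
  "nondegenerate_reps m dX =
     {(rs, D) \<in> line_reps m. nondegenerate m (sum_list rs) (blk rs) dX D}"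

lemma blk_image_reps:
  assumes "(rs, D) \<in> line_reps m"
  shows "blk rs ` {..<sum_list rs} = {..<m}"
  by (rule blk_image) (use assms in \<open>auto simp: line_reps_def\<close>)

text \<open>Saturation under the equivalence lets the set descend to the quotient.\<close>

lemma nondegenerate_reps_equiv:
  assumes "(x, y) \<in> line_equiv m dX" "x \<in> nondegenerate_reps m dX"
  shows "y \<in> nondegenerate_reps m dX"
proof -
  obtain rs D rs' D' where xy: "x = (rs, D)" "y = (rs', D')"
    by (cases x, cases y)
  from assms(1) obtain h k where
    reps: "(rs, D) \<in> line_reps m" "(rs', D') \<in> line_reps m"
    and hk: "is_isometry m dX k" "bij_betw h {0..<sum_list rs} {0..<sum_list rs'}"
      "\<forall>a<sum_list rs. \<forall>b<sum_list rs. D' (h a) (h b) = D a b"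
      "\<forall>a<sum_list rs. k (blk rs a) = blk rs' (h a)"
    unfolding line_equiv_def xy by auto
  have "nondegenerate m (sum_list rs) (blk rs) dX D"
    using assms(2) by (simp add: nondegenerate_reps_def xy)
  then have "nondegenerate m (sum_list rs') (blk rs') dX D'"
    by (rule nondegenerate_transfer[OF equalityD1[OF blk_image_reps[OF reps(1)]] hk])
  then show ?thesis
    using reps by (simp add: nondegenerate_reps_def xy)
qed

lemma nondegenerate_reps_open:
  assumes "mat_injective m (sim dX)"
  shows "reps_open m (nondegenerate_reps m dX)"
  unfolding reps_open_def
proof (intro conjI ballI, safe)
  show "(rs, D) \<in> line_reps m" if "(rs, D) \<in> nondegenerate_reps m dX" for rs D
    using that by (simp add: nondegenerate_reps_def)
next
  fix rs D assume "(rs, D) \<in> nondegenerate_reps m dX"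
  then have reps: "(rs, D) \<in> line_reps m" and "nondegenerate m (sum_list rs) (blk rs) dX D"
    by (auto simp: nondegenerate_reps_def)
  then show "\<exists>e>0. \<forall>D'. (rs, D') \<in> line_reps m \<and>
      (\<forall>i<sum_list rs. \<forall>j<sum_list rs. \<bar>D' i j - D i j\<bar> < e)
      \<longrightarrow> (rs, D') \<in> nondegenerate_reps m dX"
    using nondegenerate_open[OF blk_image_reps[OF reps] assms]
    unfolding nondegenerate_reps_def by fastforce
qed

text \<open>The interval (0, \<open>e\<close>) is infinite and only finitely many shifts are
  degenerate, so some nondegenerate shift moves every entry by less than \<open>e\<close>.\<close>

lemma nondegenerate_reps_approx:
  assumes X: "\<And>i. i < m \<Longrightarrow> dX i i = 0" and reps: "(rs, D) \<in> line_reps m" and "e > 0"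
  shows "\<exists>D'. (rs, D') \<in> nondegenerate_reps m dX \<and> (\<forall>i j. \<bar>D' i j - D i j\<bar> < e)"
proof -
  let ?n = "sum_list rs"
  have "infinite {0<..<e}"
    using \<open>e > 0\<close> by (simp add: infinite_Ioo)
  moreover have "finite {s. \<not> nondegenerate m ?n (blk rs) dX (shift_dist ?n s D)}"
    by (rule finite_degenerate_shifts[OF equalityD1[OF blk_image_reps[OF reps]] X])
  ultimately have "\<not> {0<..<e} \<subseteq> {s. \<not> nondegenerate m ?n (blk rs) dX (shift_dist ?n s D)}"
    using finite_subset by blast
  then obtain s where s: "0 < s" "s < e" "nondegenerate m ?n (blk rs) dX (shift_dist ?n s D)"
    by auto
  have "is_metric ?n (shift_dist ?n s D)"
    by (rule is_metric_shift_dist) (use reps s in \<open>auto simp: line_reps_def\<close>)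
  then have "(rs, shift_dist ?n s D) \<in> line_reps m"
    using reps by (auto simp: line_reps_def shift_dist_def)
  then have "(rs, shift_dist ?n s D) \<in> nondegenerate_reps m dX"
    using s by (simp add: nondegenerate_reps_def)
  moreover have "\<bar>shift_dist ?n s D i j - D i j\<bar> < e" for i j
    using s by (simp add: shift_dist_def)
  ultimately show ?thesis
    by blast
qed

section \<open>Descent to the space of lines\<close>

theorem theorem4p1:
  fixes m :: nat and dX :: "nat \<Rightarrow> nat \<Rightarrow> real"
  assumes "is_metric m dX"
    and "sim_invertible m dX"
  shows "\<exists>V. lines_open m dX V \<and> lines_dense m dX V \<and>
    (\<forall>C\<in>V. \<forall>(rs, D)\<in>C.
       (\<forall>\<^sub>F t in at_right 0. has_magnitude (sum_list rs) (line_dist dX rs D t)) \<and>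
       ((\<lambda>t. magnitude (sum_list rs) (line_dist dX rs D t))
          \<longlongrightarrow> magnitude m dX) (at_right 0))"
proof -
  note inj = sim_invertible_imp_mat_injective[OF assms(2)]
  have X0: "dX i i = 0" if "i < m" for i
    using assms(1) that by (auto simp: is_metric_def)
  have Xsym: "dX i j = dX j i" if "i < m" "j < m" for i j
    using assms(1) that by (auto simp: is_metric_def)
  define G where "G = nondegenerate_reps m dX"
  define V where "V = {C \<in> lines m dX. C \<subseteq> G}"
  have G_reps: "G \<subseteq> line_reps m"
    by (auto simp: G_def nondegenerate_reps_def)
  have V_sub: "V \<subseteq> lines m dX"
    by (auto simp: V_def)
  \<comment> \<open>Openness in the quotient is tested on the union of the classes; saturation
    places the class of each element of \<open>G\<close> in \<open>V\<close>.\<close>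
  have "\<Union>V = G"
  proof
    show "\<Union>V \<subseteq> G"
      by (auto simp: V_def)
    show "G \<subseteq> \<Union>V"
    proof
      fix x assume x: "x \<in> G"
      let ?C = "line_equiv m dX `` {x}"
      have "?C \<in> lines m dX"
        unfolding lines_def using x G_reps by (intro quotientI) blast
      moreover have "?C \<subseteq> G"
        using nondegenerate_reps_equiv x unfolding G_def by blast
      moreover have "x \<in> ?C"
        using line_equiv_refl x G_reps by blast
      ultimately show "x \<in> \<Union>V"
        unfolding V_def by blast
    qed
  qed
  then have "lines_open m dX V"
    using V_sub nondegenerate_reps_open[OF inj] by (simp add: lines_open_def G_def)
  moreover have "lines_dense m dX V"
    unfolding lines_dense_def
  proof (intro conjI allI impI V_sub)
    fix W assume W: "lines_open m dX W \<and> W \<noteq> {}"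
    then obtain C where C: "C \<in> W" "C \<in> lines m dX"
      by (auto simp: lines_open_def)
    then obtain x where "x \<in> line_reps m" "C = line_equiv m dX `` {x}"
      by (auto simp: lines_def elim: quotientE)
    then have "x \<in> \<Union>W"
      using C line_equiv_refl by blast
    then obtain rs D where x: "(rs, D) \<in> \<Union>W"
      by (metis surj_pair)
    then have reps: "(rs, D) \<in> line_reps m"
      using W by (auto simp: lines_open_def reps_open_def)
    have "reps_open m (\<Union>W)"
      using W by (simp add: lines_open_def)
    then have "\<exists>e>0. \<forall>D'. (rs, D') \<in> line_reps m \<and>
        (\<forall>i<sum_list rs. \<forall>j<sum_list rs. \<bar>D' i j - D i j\<bar> < e) \<longrightarrow> (rs, D') \<in> \<Union>W"
      using bspec[OF conjunct2[OF iffD1[OF reps_open_def]] x] by simp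
    then obtain e where e: "e > 0" "\<And>D'. (rs, D') \<in> line_reps m \<Longrightarrow>
        \<forall>i<sum_list rs. \<forall>j<sum_list rs. \<bar>D' i j - D i j\<bar> < e \<Longrightarrow> (rs, D') \<in> \<Union>W"
      by blast
    \<comment> \<open>A representative from the open set \<open>W\<close> is perturbed within its
      radius \<open>e\<close>, so the result lies both in \<open>G\<close> and in a class belonging
      to \<open>W\<close>.\<close>
    obtain D' where D': "(rs, D') \<in> G" "\<And>i j. \<bar>D' i j - D i j\<bar> < e"
      using nondegenerate_reps_approx[where dX = dX, OF X0 reps e(1)] unfolding G_def by blast
    then have "(rs, D') \<in> \<Union>W"
      using e(2)[of D'] G_reps by auto
    then obtain C' where C': "C' \<in> W" "(rs, D') \<in> C'"
      by blast
    then have "C' \<in> lines m dX"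
      using W by (auto simp: lines_open_def)
    then obtain y where y: "C' = line_equiv m dX `` {y}"
      by (auto simp: lines_def elim: quotientE)
    \<comment> \<open>The class is known only through some representative \<open>y\<close>: symmetry
      carries membership in \<open>G\<close> from \<open>(rs, D')\<close> back to \<open>y\<close>,
      and saturation then spreads it over the whole class.\<close>
    then have "y \<in> G"
      using C'(2) D'(1) line_equiv_sym nondegenerate_reps_equiv unfolding G_def by blast
    then have "C' \<subseteq> G"
      using y nondegenerate_reps_equiv unfolding G_def by blast
    then show "W \<inter> V \<noteq> {}"
      using C'(1) \<open>C' \<in> lines m dX\<close> by (auto simp: V_def)
  qed
  moreover have "(\<forall>\<^sub>F t in at_right 0. has_magnitude (sum_list rs) (line_dist dX rs D t)) \<and>
      ((\<lambda>t. magnitude (sum_list rs) (line_dist dX rs D t)) \<longlongrightarrow> magnitude m dX) (at_right 0)"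
    if "(rs, D) \<in> G" for rs D
  proof -
    have reps: "(rs, D) \<in> line_reps m" and nondeg: "nondegenerate m (sum_list rs) (blk rs) dX D"
      using that by (auto simp: G_def nondegenerate_reps_def)
    have Dsym: "D a b = D b a" if "a < sum_list rs" "b < sum_list rs" for a b
      using reps that by (auto simp: line_reps_def is_metric_def)
    have "line_dist dX rs D t = (\<lambda>a b. t * D a b + (1 - t) * dX (blk rs a) (blk rs b))" for t
      by (simp add: line_dist_def fun_eq_iff)
    then show ?thesis
      using magnitude_tendsto[where dX = dX and D = D, OF blk_image_reps[OF reps] inj Xsym Dsym nondeg] by simp
  qed
  ultimately show ?thesis
    unfolding V_def by blast
qed

end
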